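(* Let $G_1$ and $G_2$ be graphs and let $H = G_1 \circ G_2$ be their lexicographic product. Then for every word-representable subgraph $G_1'$ of $G_1$, the lexicographic map $\mathcal{L}_H(G_1')$ is word-representable.
   Context: All graphs are simple, undirected and finite. A graph $G$ is word-representable if there is a word $w$ over the alphabet $V(G)$ such that for all distinct $x,y \in V(G)$, $xy \in E(G)$ iff the occurrences of $x$ and $y$ alternate in $w$. The lexicographic product $H = G_1 \circ G_2$ has vertex set $V(G_1)\times V(G_2)$, with $(u,v)$ and $(x,y)$ adjacent iff $\{u,x\}\in E(G_1)$, or $u=x$ and $\{v,y\}\in E(G_2)$. For $v_i \in V(G_1)$ the supervertex $V_i = \{(v_i,u) : u \in V(G_2)\}$. For a subgraph $G_1'$ of $G_1$, the lexicographic map $\mathcal{L}_H(G_1')$ is the subgraph of $H$ on vertex set $V(H)$ containing no edges inside any supervertex and, for each edge $v_iv_j \in E(G_1')$, all edges between $V_i$ and $V_j$ (and no other edges). *)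

theory Defs
  imports "Graph_Theory.Graph_Theory"
begin

text \<open>
  Finite simple undirected graphs are the \<open>pair_graph\<close>s of \<open>Graph_Theory\<close>: finite, loop-free
  digraphs with a symmetric arc set, an edge \<open>{u, v}\<close> being the pair of arcs \<open>(u, v)\<close>, \<open>(v, u)\<close>.
\<close>

text \<open>Deleting all letters other than \<open>x\<close> and \<open>y\<close> leaves \<open>xyxy\<dots>\<close> or \<open>yxyx\<dots>\<close>.\<close>

definition alternate_in :: "'a list \<Rightarrow> 'a \<Rightarrow> 'a \<Rightarrow> bool" where
  "alternate_in w x y \<longleftrightarrow> distinct_adj (filter (\<lambda>z. z = x \<or> z = y) w)"

definition represents :: "'a list \<Rightarrow> 'a pair_pre_digraph \<Rightarrow> bool" where
  "represents w G \<longleftrightarrow> set w \<subseteq> pverts G \<and>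
     (\<forall>x \<in> pverts G. \<forall>y \<in> pverts G. x \<noteq> y \<longrightarrow> ((x, y) \<in> parcs G \<longleftrightarrow> alternate_in w x y))"

definition word_representable :: "'a pair_pre_digraph \<Rightarrow> bool" where
  "word_representable G \<longleftrightarrow> (\<exists>w. represents w G)"

definition lex_product ::
    "'a pair_pre_digraph \<Rightarrow> 'b pair_pre_digraph \<Rightarrow> ('a \<times> 'b) pair_pre_digraph" where
  "lex_product G1 G2 =
     \<lparr> pverts = pverts G1 \<times> pverts G2,
       parcs = {((u, v), (x, y)) | u v x y.
         (u, v) \<in> pverts G1 \<times> pverts G2 \<and> (x, y) \<in> pverts G1 \<times> pverts G2 \<and>
         ((u, x) \<in> parcs G1 \<or> u = x \<and> (v, y) \<in> parcs G2)} \<rparr>"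

definition supervertex :: "('a \<times> 'b) pair_pre_digraph \<Rightarrow> 'a \<Rightarrow> ('a \<times> 'b) set" where
  "supervertex H v = {p \<in> pverts H. fst p = v}"

definition lex_map ::
    "('a \<times> 'b) pair_pre_digraph \<Rightarrow> 'a pair_pre_digraph \<Rightarrow> ('a \<times> 'b) pair_pre_digraph" where
  "lex_map H G' =
     \<lparr> pverts = pverts H,
       parcs = (\<Union>(u, v) \<in> parcs G'. supervertex H u \<times> supervertex H v) \<rparr>"

lemma supervertex_lex_product:
  "v \<in> pverts G1 \<Longrightarrow> supervertex (lex_product G1 G2) v = {(v, u) | u. u \<in> pverts G2}"
  by (auto simp: supervertex_def lex_product_def)

lemma pair_graphI:
  assumes "finite (pverts G)" "parcs G \<subseteq> pverts G \<times> pverts G"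
    and "\<And>u v. (u, v) \<in> parcs G \<Longrightarrow> (v, u) \<in> parcs G" "\<And>u. (u, u) \<notin> parcs G"
  shows "pair_graph G"
proof
  show "finite (parcs G)" using assms(1,2) by (meson finite_SigmaI finite_subset)
  show "symmetric (with_proj G)" using assms(3) by (auto simp: symmetric_def sym_def)
qed (use assms in force)+

lemma pair_graph_symD: "pair_graph G \<Longrightarrow> (u, v) \<in> parcs G \<Longrightarrow> (v, u) \<in> parcs G"
proof -
  assume "pair_graph G" "(u, v) \<in> parcs G"
  then interpret pair_graph G by simp
  show ?thesis using \<open>(u, v) \<in> parcs G\<close> pair_sym_arcs by (auto simp: symmetric_def dest: symD)
qed

lemma pair_graph_irrefl: "pair_graph G \<Longrightarrow> (u, u) \<notin> parcs G"
  by (metis fst_conv pair_graph.axioms(1) pair_digraph.axioms(2)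
      pair_loopfree_digraph.pair_no_loops snd_conv)

lemma pair_graph_lex_product:
  assumes "pair_graph G1" "pair_graph G2"
  shows "pair_graph (lex_product G1 G2)"
proof -
  interpret G1: pair_graph G1 by fact
  interpret G2: pair_graph G2 by fact
  show ?thesis
    by (rule pair_graphI)
      (use assms in \<open>auto simp: lex_product_def pair_graph_irrefl intro: pair_graph_symD\<close>)
qed

lemma pair_graph_lex_map:
  assumes "pair_graph H" "pair_graph G'"
  shows "pair_graph (lex_map H G')"
proof -
  interpret H: pair_graph H by fact
  show ?thesis
    by (rule pair_graphI)
      (use assms in \<open>auto simp: lex_map_def supervertex_def pair_graph_irrefl
         intro: pair_graph_symD dest: pair_graph_symD[OF assms(2)] split: prod.splits\<close>)
qed

lemma subgraph_lex_map:
  assumes "pair_graph G1" "pair_graph G2" "pair_graph G'" "subgraph G' G1"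
  shows "subgraph (lex_map (lex_product G1 G2) G') (lex_product G1 G2)"
proof -
  interpret P: pair_graph "lex_product G1 G2" using assms by (intro pair_graph_lex_product)
  interpret M: pair_graph "lex_map (lex_product G1 G2) G'"
    using assms by (intro pair_graph_lex_map pair_graph_lex_product)
  have "parcs G' \<subseteq> parcs G1" using assms(4) by (auto simp: subgraph_def)
  then show ?thesis
    unfolding subgraph_def using P.wf_digraph M.wf_digraph
    by (fastforce simp: compatible_def lex_map_def lex_product_def supervertex_def)
qed

text \<open>
  A representing word may be required to contain every letter: a missing letter can be put once
  in front.
\<close>

lemma word_representable_iff_all_letters:
  assumes "finite (pverts G)"
  shows "word_representable G \<longleftrightarrow> (\<exists>w. represents w G \<and> set w = pverts G)"
proof
  assume "word_representable G"
  then obtain w where w: "represents w G" by (auto simp: word_representable_def)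
  obtain m where m: "set m = pverts G - set w" "distinct m"
    using assms finite_distinct_list[of "pverts G - set w"] by auto
  have alt: "alternate_in (m @ w) x y \<longleftrightarrow> alternate_in w x y" if "x \<noteq> y" for x y
  proof -
    let ?f = "filter (\<lambda>z. z = x \<or> z = y)"
    have d: "distinct (?f m)" using m(2) by simp
    have disj: "set (?f m) \<inter> set (?f w) = {}" using m(1) by auto
    have "distinct_adj (?f m @ ?f w) \<longleftrightarrow> distinct_adj (?f w)"
    proof -
      have "distinct_adj (?f m)" using d by (auto simp: distinct_adj_conv_nth nth_eq_iff_index_eq)
      moreover have "?f m \<noteq> [] \<Longrightarrow> ?f w \<noteq> [] \<Longrightarrow> last (?f m) \<noteq> hd (?f w)"
        using disj by (metis IntI empty_iff hd_in_set last_in_set)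
      ultimately show ?thesis by (auto simp: distinct_adj_append_iff)
    qed
    then show ?thesis by (simp add: alternate_in_def)
  qed
  have "represents (m @ w) G" "set (m @ w) = pverts G"
    using w m(1) alt by (auto simp: represents_def)
  then show "\<exists>w. represents w G \<and> set w = pverts G" by blast
qed (auto simp: word_representable_def)

end

theory Submission
  imports Defs
begin

text \<open>
  Take a word \<open>w\<close> representing \<open>G\<^sub>1'\<close> that contains every vertex of \<open>G\<^sub>1\<close> (a vertex outside
  \<open>G\<^sub>1'\<close> is isolated and can be appended as a square). Appending to \<open>w\<close> its letters in the
  order of their last occurrences changes no alternation. Now replace every letter \<open>v\<close> by the
  supervertex of \<open>v\<close>, listed in a fixed order inside \<open>w\<close> and in the reverse order inside the
  appended permutation. Vertices of different supervertices alternate exactly as their first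
  components did, whereas the change of direction destroys the alternation of any two vertices
  of the same supervertex.
\<close>

lemma last_remdups: "last (remdups xs) = last xs"
  by (induction xs) auto

text \<open>\<open>remdups\<close> keeps last occurrences, so \<open>remdups u\<close> ends in the
  last letter of \<open>u\<close>. Having at least two letters and no repetition, it starts with a
  different one, so no equal neighbours arise at the seam.\<close>

lemma distinct_adj_append_remdups:
  assumes "x \<in> set u" "y \<in> set u" "x \<noteq> y"
  shows "distinct_adj (u @ remdups u) \<longleftrightarrow> distinct_adj u"
proof -
  obtain a r where r: "remdups u = a # r" using assms(1) by (cases "remdups u") auto
  have d: "distinct (a # r)" using distinct_remdups[of u] r by simp
  have s: "set (a # r) = set u" using r by (metis set_remdups)
  have "r \<noteq> []" using assms by (auto simp flip: s)
  have "last u = last (remdups u)" by (simp add: last_remdups)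
  then have "last u \<noteq> hd (remdups u)" using \<open>r \<noteq> []\<close> d r by auto
  moreover have "distinct_adj (remdups u)"
    by (simp add: distinct_adj_conv_nth nth_eq_iff_index_eq)
  ultimately show ?thesis by (auto simp: distinct_adj_append_iff)
qed

lemma alternate_in_append_remdups:
  assumes "x \<in> set w" "y \<in> set w" "x \<noteq> y"
  shows "alternate_in (w @ remdups w) x y \<longleftrightarrow> alternate_in w x y"
  using distinct_adj_append_remdups[of x "filter (\<lambda>z. z = x \<or> z = y) w" y] assms
  by (simp add: alternate_in_def remdups_filter)

text \<open>Bridges the gap between a subgraph, which may miss vertices of the host graph, and its
  lexicographic map, which lives on all of them.\<close>

lemma represents_isolated_vertices:
  assumes "represents w G" "finite V" "pverts G \<subseteq> V" "parcs G \<subseteq> pverts G \<times> pverts G"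
  shows "\<exists>w'. represents w' (G\<lparr>pverts := V\<rparr>)"
proof -
  obtain zs where zs: "set zs = V - pverts G"
    using assms(2) finite_list[of "V - pverts G"] by auto
  define w' where "w' = w @ concat (map (\<lambda>z. [z, z]) zs)"
  have old: "alternate_in w' x y \<longleftrightarrow> alternate_in w x y" if "x \<in> pverts G" "y \<in> pverts G" for x y
  proof -
    have "filter (\<lambda>z. z = x \<or> z = y) (concat (map (\<lambda>z. [z, z]) zs)) = []"
      using zs that by (auto simp: filter_empty_conv)
    then show ?thesis by (simp add: alternate_in_def w'_def)
  qed
  \<comment> \<open>The factor \<open>[z, z]\<close> survives restriction to any pair of letters
    containing \<open>z\<close>.\<close>
  have new: "\<not> alternate_in w' x y" if xy: "x \<in> set zs \<or> y \<in> set zs" for x y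
  proof -
    obtain z where z: "z \<in> set zs" "z = x \<or> z = y" using xy by blast
    obtain us vs where "zs = us @ z # vs" using z(1) by (auto dest: split_list)
    then show ?thesis
      using z(2) by (auto simp: alternate_in_def w'_def distinct_adj_append_iff)
  qed
  have "set w' \<subseteq> V" using assms(1,3) zs by (auto simp: w'_def represents_def)
  moreover have "(x, y) \<in> parcs G \<longleftrightarrow> alternate_in w' x y"
    if "x \<in> V" "y \<in> V" "x \<noteq> y" for x y
  proof (cases "x \<in> pverts G \<and> y \<in> pverts G")
    case True
    then show ?thesis using old assms(1) that(3) by (auto simp: represents_def)
  next
    case False
    then show ?thesis using new[of x y] assms(4) zs that by auto
  qed
  ultimately show ?thesis by (auto simp: represents_def)
qed

definition blow_up :: "'b list \<Rightarrow> 'a list \<Rightarrow> ('a \<times> 'b) list" where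
  "blow_up us w = concat (map (\<lambda>v. map (Pair v) us) w)"

lemma set_blow_up: "set (blow_up us w) = set w \<times> set us"
  by (auto simp: blow_up_def)

lemma blow_up_append: "blow_up us (w @ w') = blow_up us w @ blow_up us w'"
  by (simp add: blow_up_def)

lemma blow_up_Cons: "blow_up us (v # w) = map (Pair v) us @ blow_up us w"
  by (simp add: blow_up_def)

lemma filter_eq_singleton:
  assumes "distinct us" "a \<in> set us"
  shows "filter (\<lambda>z. z = a) us = [a]"
  using assms by (induction us) (auto simp: filter_empty_conv)

text \<open>As \<open>us\<close> is distinct and \<open>x \<noteq> y\<close>, each block of
  \<open>x\<close> or \<open>y\<close> contributes exactly one letter, wherever \<open>a\<close> and
  \<open>b\<close> stand in \<open>us\<close>. Hence the formula applies to \<open>us\<close> and to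
  \<open>rev us\<close> alike.\<close>

lemma filter_blow_up:
  assumes "distinct us" "a \<in> set us" "b \<in> set us" "x \<noteq> y"
  shows "filter (\<lambda>p. p = (x, a) \<or> p = (y, b)) (blow_up us w) =
    map (\<lambda>z. if z = x then (x, a) else (y, b)) (filter (\<lambda>z. z = x \<or> z = y) w)"
proof (induction w)
  case Nil
  show ?case by (simp add: blow_up_def)
next
  case (Cons v w)
  have "filter (\<lambda>p. p = (x, a) \<or> p = (y, b)) (map (Pair v) us) =
      (if v = x then [(x, a)] else if v = y then [(y, b)] else [])"
    using assms by (auto simp: filter_map comp_def filter_eq_singleton)
  then show ?case using Cons assms(4) by (simp add: blow_up_Cons)
qed

lemma alternate_in_blow_up_distinct_fst:
  assumes "distinct us" "a \<in> set us" "b \<in> set us" "x \<noteq> y"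
  shows "alternate_in (blow_up us w @ blow_up (rev us) w') (x, a) (y, b) \<longleftrightarrow>
    alternate_in (w @ w') x y"
proof -
  let ?g = "\<lambda>z. if z = x then (x, a) else (y, b)"
  have "inj_on ?g {x, y}" using assms(4) by (auto simp: inj_on_def)
  then have inj: "inj_on ?g (set (filter (\<lambda>z. z = x \<or> z = y) (w @ w')))"
    by (rule inj_on_subset) auto
  have "filter (\<lambda>p. p = (x, a) \<or> p = (y, b)) (blow_up us w @ blow_up (rev us) w') =
      map ?g (filter (\<lambda>z. z = x \<or> z = y) (w @ w'))"
    using filter_blow_up[of us a b x y w] filter_blow_up[of "rev us" a b x y w'] assms by simp
  then show ?thesis
    unfolding alternate_in_def using distinct_adj_map_iff[OF inj] by simp
qed

text \<open>The block of the last \<open>v\<close> in \<open>w\<close> and that of the first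
  \<open>v\<close> in \<open>w'\<close> restrict to \<open>c\<close> and \<open>rev c\<close>, with
  nothing between them. At the seam the last letter of \<open>c\<close> meets itself.\<close>

lemma not_alternate_in_blow_up_same_fst:
  assumes "a \<in> set us" "v \<in> set w" "v \<in> set w'"
  shows "\<not> alternate_in (blow_up us w @ blow_up (rev us) w') (v, a) (v, b)"
proof -
  let ?F = "filter (\<lambda>p. p = (v, a) \<or> p = (v, b))"
  obtain w1 w2 where w: "w = w1 @ v # w2" "v \<notin> set w2"
    using assms(2) by (auto dest: split_list_last)
  obtain r1 r2 where w': "w' = r1 @ v # r2" "v \<notin> set r1"
    using assms(3) by (auto dest: split_list_first)
  define c where "c = ?F (map (Pair v) us)"
  have c: "c \<noteq> []" using assms(1) by (auto simp: c_def filter_empty_conv)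
  have "?F (blow_up us w2) = []" "?F (blow_up (rev us) r1) = []"
    using w(2) w'(2) by (auto simp: filter_empty_conv set_blow_up)
  then have "?F (blow_up us w @ blow_up (rev us) w') =
      (?F (blow_up us w1) @ c) @ (rev c @ ?F (blow_up (rev us) r2))"
    by (simp add: w(1) w'(1) blow_up_append blow_up_Cons c_def rev_filter rev_map)
  then show ?thesis
    using c by (simp add: alternate_in_def distinct_adj_append_iff hd_rev)
qed

text \<open>\<open>lex_map\<close> reads only the vertex set of \<open>H\<close>, so a product form
  of \<open>pverts H\<close> is all that is assumed about its structure.\<close>

lemma word_representable_lex_map:
  assumes "word_representable G" "finite (pverts G)" "\<And>v. (v, v) \<notin> parcs G"
    and H: "pverts H = pverts G \<times> U" "finite U"
  shows "word_representable (lex_map H G)"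
proof -
  obtain w where w: "represents w G" "set w = pverts G"
    using assms(1,2) word_representable_iff_all_letters by blast
  obtain us where us: "set us = U" "distinct us" using H(2) finite_distinct_list by blast
  define W where "W = blow_up us w @ blow_up (rev us) (remdups w)"
  have alt: "alternate_in W (x, a) (y, b) \<longleftrightarrow> (x, y) \<in> parcs G"
    if "x \<in> pverts G" "y \<in> pverts G" "a \<in> U" "b \<in> U" for x y a b
  proof (cases "x = y")
    case True
    \<comment> \<open>Both sides are false: \<open>G\<close> has no loops, and the reversal destroys
      the alternation.\<close>
    then show ?thesis
      using not_alternate_in_blow_up_same_fst[of a us x w "remdups w" b] that us w(2) assms(3)
      by (simp add: W_def)
  next
    case False
    then have "alternate_in W (x, a) (y, b) \<longleftrightarrow> alternate_in w x y"
      using alternate_in_blow_up_distinct_fst[of us a b x y w "remdups w"]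
        alternate_in_append_remdups[of x w y] that us w(2) by (simp add: W_def)
    then show ?thesis using w(1) that False by (auto simp: represents_def)
  qed
  have "set W \<subseteq> pverts H" using us w(2) H(1) by (auto simp: W_def set_blow_up)
  then have "represents W (lex_map H G)"
    using alt H(1) by (auto simp: represents_def lex_map_def supervertex_def)
  then show ?thesis by (auto simp: word_representable_def)
qed

theorem theorem4:
  fixes G1 G1' :: "'a pair_pre_digraph"
    and G2 :: "'b pair_pre_digraph"
    and H :: "('a \<times> 'b) pair_pre_digraph"
  assumes "pair_graph G1" and "pair_graph G2"
    and "H = lex_product G1 G2"
    and "pair_graph G1'" and "subgraph (with_proj G1') (with_proj G1)"
    and "word_representable G1'"
  shows "word_representable (lex_map H G1')"
proof -
  interpret G1: pair_graph G1 by fact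
  interpret G2: pair_graph G2 by fact
  interpret G1': pair_graph G1' by fact
  let ?G = "G1'\<lparr>pverts := pverts G1\<rparr>"
  have "pverts G1' \<subseteq> pverts G1" using assms(5) by (auto simp: subgraph_def)
  moreover have "parcs G1' \<subseteq> pverts G1' \<times> pverts G1'"
    by (auto dest: G1'.in_arcsD1 G1'.in_arcsD2)
  ultimately have "word_representable ?G"
    using assms(6) represents_isolated_vertices[of _ G1' "pverts G1"]
    by (auto simp: word_representable_def)
  then have "word_representable (lex_map H ?G)"
    by (rule word_representable_lex_map[where U = "pverts G2"])
      (use assms(3,4) in \<open>auto simp: lex_product_def pair_graph_irrefl\<close>)
  \<comment> \<open>\<open>lex_map\<close> depends on its second argument only through the arcs,
    which \<open>?G\<close> shares with \<open>G1'\<close>.\<close>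
  then show ?thesis by (simp add: lex_map_def)
qed

end
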